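(* Let $D$ be a multipartite tournament with ordered strong components $Q_1,\ldots,Q_s$ for some integer $s\ge 2$, and let $Q_t$ ($t<s$) be the last nontrivial component of $D$. If $Q_t$ is primitive, then the graph sequence $\{C^m(D)\}_{m=1}^{\infty}$ converges to a graph isomorphic to $K[D_{1\sim t}]\cup I[D_{t+1\sim s}]$.
   Context: All digraphs are finite with simple underlying graph. For a positive integer $m$, the $m$-step competition graph $C^m(D)$ of a digraph $D$ is the simple graph with vertex set $V(D)$ in which two distinct vertices $u,v$ are adjacent iff there is a vertex $w$ such that there are directed walks of length exactly $m$ from $u$ to $w$ and from $v$ to $w$. The sequence $\{C^m(D)\}_{m=1}^\infty$ converges to a graph $G$ if $C^m(D)=G$ for all sufficiently large $m$. A multipartite tournament is an orientation of a complete $k$-partite graph for some $k\ge 2$. Ordered strong components of $D$ are its strong components arranged as $Q_1,\ldots,Q_s$ so that there is no arc from $Q_i$ to $Q_j$ whenever $i>j$. A strong component is trivial if it has exactly one vertex and nontrivial otherwise. The last nontrivial component is the nontrivial $Q_t$ such that $Q_i$ is trivial for every $t<i\le s$. $D_{\alpha\sim\beta}$ denotes the subdigraph induced by $\bigcup_{i=\alpha}^{\beta}V(Q_i)$. A nontrivial strongly connected digraph is primitive if the greatest common divisor of the lengths of its closed directed walks is $1$. $\cup$ denotes disjoint union of graphs. For a digraph $H$, $K[H]$ and $I[H]$ are the complete graph and the edgeless graph with vertex set $V(H)$. *)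

theory Defs
  imports
    "Graph_Theory.Digraph_Isomorphism"
    "HOL-Library.Disjoint_Sets"
begin

text \<open>
  Simple graphs are represented, as in the \<open>Graph_Theory\<close> library, by symmetric loop-free
  digraphs without parallel arcs; an edge is a pair of opposite arcs of an \<open>'a pair_pre_digraph\<close>.
\<close>

definition simple_underlying :: "('a, 'b) pre_digraph \<Rightarrow> bool" where
  "simple_underlying D \<longleftrightarrow> digraph D \<and> (\<forall>u v. u \<rightarrow>\<^bsub>D\<^esub> v \<longrightarrow> \<not> v \<rightarrow>\<^bsub>D\<^esub> u)"

definition orientation_of :: "('a, 'b) pre_digraph \<Rightarrow> 'a pair_pre_digraph \<Rightarrow> bool" where
  "orientation_of D G \<longleftrightarrow> simple_underlying D \<and> mk_symmetric D = G"

text \<open>The parts are nonempty, by definition of \<^const>\<open>partition_on\<close>.\<close>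

definition complete_partite :: "nat \<Rightarrow> 'a pair_pre_digraph \<Rightarrow> bool" where
  "complete_partite k G \<longleftrightarrow> finite (pverts G) \<and>
     (\<exists>P. partition_on (pverts G) P \<and> card P = k \<and>
          parcs G = {(u, v). \<exists>A\<in>P. \<exists>B\<in>P. A \<noteq> B \<and> u \<in> A \<and> v \<in> B})"

definition multipartite_tournament :: "('a, 'b) pre_digraph \<Rightarrow> bool" where
  "multipartite_tournament D \<longleftrightarrow> (\<exists>k\<ge>2. \<exists>G. complete_partite k G \<and> orientation_of D G)"

definition step_competition_graph :: "nat \<Rightarrow> ('a, 'b) pre_digraph \<Rightarrow> 'a pair_pre_digraph" where
  "step_competition_graph m D =
     \<lparr> pverts = verts D,
       parcs = {(u, v). u \<in> verts D \<and> v \<in> verts D \<and> u \<noteq> v \<and>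
                  (\<exists>w. (\<exists>p. pre_digraph.awalk D u p w \<and> length p = m) \<and>
                       (\<exists>q. pre_digraph.awalk D v q w \<and> length q = m))} \<rparr>"

definition graph_seq_converges :: "(nat \<Rightarrow> 'a pair_pre_digraph) \<Rightarrow> 'a pair_pre_digraph \<Rightarrow> bool" where
  "graph_seq_converges X G \<longleftrightarrow> (\<forall>\<^sub>F m in sequentially. X m = G)"

definition ordered_strong_components ::
    "('a, 'b) pre_digraph \<Rightarrow> nat \<Rightarrow> (nat \<Rightarrow> ('a, 'b) pre_digraph) \<Rightarrow> bool" where
  "ordered_strong_components D s Q \<longleftrightarrow>
     bij_betw Q {1..s} (pre_digraph.sccs D) \<and>
     (\<forall>i\<in>{1..s}. \<forall>j\<in>{1..s}. i > j \<longrightarrow>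
        \<not> (\<exists>u\<in>verts (Q i). \<exists>v\<in>verts (Q j). u \<rightarrow>\<^bsub>D\<^esub> v))"

definition trivial_component :: "('a, 'b) pre_digraph \<Rightarrow> bool" where
  "trivial_component H \<longleftrightarrow> card (verts H) = 1"

definition last_nontrivial_component ::
    "nat \<Rightarrow> (nat \<Rightarrow> ('a, 'b) pre_digraph) \<Rightarrow> nat \<Rightarrow> bool" where
  "last_nontrivial_component s Q t \<longleftrightarrow>
     t \<in> {1..s} \<and> \<not> trivial_component (Q t) \<and>
     (\<forall>i. t < i \<and> i \<le> s \<longrightarrow> trivial_component (Q i))"

definition components_span ::
    "('a, 'b) pre_digraph \<Rightarrow> (nat \<Rightarrow> ('a, 'b) pre_digraph) \<Rightarrow> nat \<Rightarrow> nat \<Rightarrow> ('a, 'b) pre_digraph" where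
  "components_span D Q \<alpha> \<beta> = D \<restriction> (\<Union>i\<in>{\<alpha>..\<beta>}. verts (Q i))"

text \<open>
  The closed walks include the empty ones; their length \<open>0\<close> does not affect the \<^const>\<open>Gcd\<close>.
\<close>

definition primitive_digraph :: "('a, 'b) pre_digraph \<Rightarrow> bool" where
  "primitive_digraph H \<longleftrightarrow>
     \<not> trivial_component H \<and> strongly_connected H \<and>
     Gcd {length p | u p. pre_digraph.awalk H u p u} = 1"

definition complete_graph_on :: "('a, 'b) pre_digraph \<Rightarrow> 'a pair_pre_digraph" where
  "complete_graph_on H =
     \<lparr> pverts = verts H, parcs = {(u, v). u \<in> verts H \<and> v \<in> verts H \<and> u \<noteq> v} \<rparr>"

definition edgeless_graph_on :: "('a, 'b) pre_digraph \<Rightarrow> 'a pair_pre_digraph" where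
  "edgeless_graph_on H = \<lparr> pverts = verts H, parcs = {} \<rparr>"

definition disjoint_union ::
    "'a pair_pre_digraph \<Rightarrow> 'b pair_pre_digraph \<Rightarrow> ('a + 'b) pair_pre_digraph" where
  "disjoint_union G H =
     \<lparr> pverts = pverts G <+> pverts H,
       parcs = map_prod Inl Inl ` parcs G \<union> map_prod Inr Inr ` parcs H \<rparr>"

end

theory Submission
  imports Defs
begin

text \<open>
  A primitive component \<open>Q t\<close> has walks of every large length between any two of its vertices.
  Every vertex of an earlier component is adjacent to one of the two ends of any arc of \<open>Q t\<close>,
  because these lie in different parts, and the connecting arc can only lead into \<open>Q t\<close>. Hence
  all vertices of \<open>Q 1, \<dots>, Q t\<close> have walks of every large length to one fixed vertex. From a
  trivial component each arc leads to a component of larger index, so walks starting after \<open>Q t\<close>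
  have bounded length.
\<close>

section \<open>Additively closed sets of natural numbers with gcd 1\<close>

lemma Gcd_add_closed_consecutive:
  fixes S :: "nat set"
  assumes "0 \<in> S" and add: "\<And>a b. a \<in> S \<Longrightarrow> b \<in> S \<Longrightarrow> a + b \<in> S" and "Gcd S = 1"
  obtains a where "a \<in> S" "Suc a \<in> S"
proof -
  have mult: "k * a \<in> S" if "a \<in> S" for k a
    by (induction k) (use that \<open>0 \<in> S\<close> add in auto)
  \<comment> \<open>\<open>P d\<close> says that \<open>d\<close> is a positive difference of two
    elements of \<open>S\<close>. The least such \<open>d\<close> will be shown to divide every
    element of \<open>S\<close>, hence to be 1.\<close>
  define P where "P d \<longleftrightarrow> d > 0 \<and> (\<exists>b\<in>S. b + d \<in> S)" for d
  have "\<exists>x\<in>S. x > 0"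
  proof (rule ccontr)
    assume "\<not> (\<exists>x\<in>S. x > 0)"
    then have "S = {0}" using \<open>0 \<in> S\<close> by auto
    then show False using \<open>Gcd S = 1\<close> by simp
  qed
  then obtain x where "x \<in> S" "x > 0" by blast
  then have "P x" using \<open>0 \<in> S\<close> by (auto simp: P_def intro!: bexI[of _ 0])
  define d where "d = (LEAST d. P d)"
  have "P d" unfolding d_def by (rule LeastI) fact
  then obtain b where b: "b \<in> S" "b + d \<in> S" "d > 0" by (auto simp: P_def)
  have "d dvd x" if "x \<in> S" for x
  proof -
    let ?q = "x div d"
    \<comment> \<open>Both \<open>x + ?q * b\<close> and \<open>?q * (b + d)\<close> lie in
      \<open>S\<close>, and they differ by the remainder of \<open>x\<close> modulo
      \<open>d\<close>; minimality of \<open>d\<close> forces this remainder to be 0.\<close>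
    have "?q * (b + d) + x mod d = x + ?q * b" by (simp add: algebra_simps)
    moreover have "x + ?q * b \<in> S" "?q * (b + d) \<in> S" using that b mult add by blast+
    ultimately have "x mod d > 0 \<Longrightarrow> P (x mod d)" unfolding P_def by metis
    moreover have "\<not> P (x mod d)" using b(3) not_less_Least[of "x mod d" P] by (simp add: d_def)
    ultimately show ?thesis by (metis dvd_eq_mod_eq_0 gr_zeroI)
  qed
  then have "d dvd Gcd S" by (rule Gcd_greatest)
  then have "d = 1" using \<open>Gcd S = 1\<close> by simp
  then show ?thesis using that b by simp
qed

text \<open>With consecutive elements \<open>a\<close> and \<open>a + 1\<close>, write
  \<open>n = q * a + r\<close> with \<open>r < a\<close>. Once \<open>n \<ge> a * a\<close>, also
  \<open>r \<le> q\<close>, so \<open>n\<close> is a sum of \<open>q - r\<close> copies of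
  \<open>a\<close> and \<open>r\<close> copies of \<open>a + 1\<close>.\<close>

lemma Gcd_add_closed_eventually:
  fixes S :: "nat set"
  assumes "0 \<in> S" and add: "\<And>a b. a \<in> S \<Longrightarrow> b \<in> S \<Longrightarrow> a + b \<in> S" and "Gcd S = 1"
  shows "\<forall>\<^sub>F n in sequentially. n \<in> S"
proof -
  obtain a where a: "a \<in> S" "Suc a \<in> S" using Gcd_add_closed_consecutive assms by blast
  have mult: "k * x \<in> S" if "x \<in> S" for k x
    by (induction k) (use that \<open>0 \<in> S\<close> add in auto)
  have "n \<in> S" if "n \<ge> a * a" for n
  \<comment> \<open>If \<open>a = 0\<close>, then \<open>S\<close> contains 1 and so every natural
    number; division by \<open>a\<close> is of use only otherwise.\<close>
  proof (cases "a = 0")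
    case True
    then show ?thesis using mult[OF a(2), of n] by simp
  next
    case False
    then have "n mod a \<le> n div a"
      using that by (meson gr0I less_eq_div_iff_mult_less_eq less_imp_le mod_less_divisor order_trans)
    then have "n = (n div a - n mod a) * a + (n mod a) * Suc a"
      by (simp add: diff_mult_distrib)
    then show ?thesis using a mult add by metis
  qed
  then show ?thesis unfolding eventually_sequentially by blast
qed

section \<open>Walks of prescribed length in primitive digraphs\<close>

definition (in pre_digraph) walk_of_length :: "nat \<Rightarrow> 'a \<Rightarrow> 'a \<Rightarrow> bool" where
  "walk_of_length n u v \<longleftrightarrow> (\<exists>p. awalk u p v \<and> length p = n)"

context wf_digraph
begin

lemma walk_of_length_trans:
  "walk_of_length m u v \<Longrightarrow> walk_of_length n v w \<Longrightarrow> walk_of_length (m + n) u w"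
  unfolding walk_of_length_def by (metis awalk_appendI length_append)

lemma walk_of_length_1:
  assumes "u \<rightarrow> v"
  shows "walk_of_length 1 u v"
proof -
  obtain e where "e \<in> arcs G" "tail G e = u" "head G e = v" using assms by (rule reachableE)
  then have "awalk u [e] v" using arc_implies_awalk by blast
  then show ?thesis unfolding walk_of_length_def by (intro exI[of _ "[e]"]) simp
qed

lemma reachable_walk_of_length: "u \<rightarrow>\<^sup>* v \<Longrightarrow> \<exists>n. walk_of_length n u v"
  by (auto simp: walk_of_length_def reachable_awalk)

lemma eventually_walk_of_length_trans:
  assumes "walk_of_length k u v" "\<forall>\<^sub>F n in sequentially. walk_of_length n v w"
  shows "\<forall>\<^sub>F n in sequentially. walk_of_length n u w"
proof -
  from assms(2) obtain N where "\<And>n. n \<ge> N \<Longrightarrow> walk_of_length n v w"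
    by (auto simp: eventually_sequentially)
  then have "walk_of_length n u w" if "n \<ge> k + N" for n
    using walk_of_length_trans[OF assms(1), of "n - k" w] that by simp
  then show ?thesis unfolding eventually_sequentially by blast
qed

text \<open>The lengths of closed walks at the fixed vertex \<open>w\<close> are closed under
  addition. Once their gcd is known to be 1, closed walks at \<open>w\<close> of every large length
  exist, and a walk from \<open>u\<close> to \<open>w\<close> can be put in front.\<close>

lemma primitive_eventually_walk:
  assumes prim: "primitive_digraph G" and "u \<in> verts G" "w \<in> verts G"
  shows "\<forall>\<^sub>F n in sequentially. walk_of_length n u w"
proof -
  have reach: "\<exists>n. walk_of_length n x y" if "x \<in> verts G" "y \<in> verts G" for x y
    using prim that reachable_walk_of_length
    by (auto simp: primitive_digraph_def strongly_connected_def)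
  define L where "L = {n. walk_of_length n w w}"
  have "0 \<in> L" using \<open>w \<in> verts G\<close> by (simp add: L_def walk_of_length_def awalk_Nil_iff)
  have L_add: "a + b \<in> L" if "a \<in> L" "b \<in> L" for a b
    using that walk_of_length_trans by (auto simp: L_def)
  \<comment> \<open>Primitivity concerns closed walks at all vertices. A round trip from
    \<open>w\<close> through \<open>x\<close>, made with and without the closed walk at
    \<open>x\<close>, gives two elements of \<open>L\<close> that differ by
    \<open>l\<close>.\<close>
  have "Gcd L dvd l" if "walk_of_length l x x" for l x
  proof -
    have "x \<in> verts G" using that by (auto simp: walk_of_length_def)
    then obtain a b where ab: "walk_of_length a w x" "walk_of_length b x w"
      using reach \<open>w \<in> verts G\<close> by blast
    then have "walk_of_length (a + b) w w" "walk_of_length (a + l + b) w w"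
      using that walk_of_length_trans by blast+
    then have "a + b \<in> L" "a + l + b \<in> L" by (simp_all add: L_def)
    then have "Gcd L dvd a + b" "Gcd L dvd l + (a + b)" by (auto simp: ac_simps)
    then show ?thesis using dvd_add_left_iff by blast
  qed
  then have "Gcd L dvd Gcd {length p | x p. awalk x p x}"
    by (intro Gcd_greatest) (auto simp: walk_of_length_def)
  then have "Gcd L = 1" using prim by (simp add: primitive_digraph_def)
  then have "\<forall>\<^sub>F n in sequentially. walk_of_length n w w"
    using Gcd_add_closed_eventually[OF \<open>0 \<in> L\<close> L_add] by (simp add: L_def)
  moreover obtain k where "walk_of_length k u w" using reach assms by blast
  ultimately show ?thesis by (rule eventually_walk_of_length_trans[rotated])
qed

lemma strongly_connected_ex_dominates:
  assumes "strongly_connected G" "card (verts G) \<noteq> 1"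
  obtains u v where "u \<rightarrow> v"
proof -
  obtain u where u: "u \<in> verts G" using assms by (auto simp: strongly_connected_def)
  moreover have "verts G \<noteq> {u}" using assms by auto
  ultimately obtain v where "v \<in> verts G" "u \<noteq> v" by blast
  then have "u \<rightarrow>\<^sup>+ v"
    using u assms by (metis reachable_neq_reachable1 strongly_connected_def)
  then show ?thesis using that by (metis converse_tranclE)
qed

end

lemma (in wf_digraph) subgraph_walk_of_length:
  "subgraph H G \<Longrightarrow> pre_digraph.walk_of_length H n u v \<Longrightarrow> walk_of_length n u v"
  unfolding pre_digraph.walk_of_length_def using subgraph_awalk_imp_awalk by blast

section \<open>Adjacency in multipartite tournaments\<close>

lemma multipartite_tournament_digraph: "multipartite_tournament D \<Longrightarrow> digraph D"
  by (auto simp: multipartite_tournament_def orientation_of_def simple_underlying_def)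

text \<open>The ends of an arc lie in different parts, so the part of \<open>x\<close> differs from
  that of \<open>a\<close> or from that of \<open>b\<close>.\<close>

lemma multipartite_tournament_adjacent_end:
  assumes "multipartite_tournament D" and "a \<rightarrow>\<^bsub>D\<^esub> b" and "x \<in> verts D"
  shows "\<exists>y\<in>{a, b}. x \<rightarrow>\<^bsub>D\<^esub> y \<or> y \<rightarrow>\<^bsub>D\<^esub> x"
proof -
  from assms(1) obtain G P where G: "mk_symmetric D = G" "partition_on (pverts G) P"
    "parcs G = {(u, v). \<exists>A\<in>P. \<exists>B\<in>P. A \<noteq> B \<and> u \<in> A \<and> v \<in> B}"
    by (auto simp: multipartite_tournament_def complete_partite_def orientation_of_def)
  have parcs: "(u, v) \<in> parcs G \<longleftrightarrow> u \<rightarrow>\<^bsub>D\<^esub> v \<or> v \<rightarrow>\<^bsub>D\<^esub> u" for u v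
    unfolding G(1)[symmetric] by (auto simp: parcs_mk_symmetric arcs_ends_conv)
  have "x \<in> \<Union>P" using G(1,2) assms(3) by (auto simp: partition_on_def)
  then obtain C where "C \<in> P" "x \<in> C" by blast
  moreover obtain A B where "A \<in> P" "B \<in> P" "A \<noteq> B" "a \<in> A" "b \<in> B"
    using parcs[of a b] assms(2) G(3) by auto
  ultimately have "(x, a) \<in> parcs G \<or> (x, b) \<in> parcs G"
    unfolding G(3) by blast
  then show ?thesis using parcs by auto
qed

lemma (in wf_digraph) Union_verts_sccs: "(\<Union>c\<in>sccs. verts c) = verts G"
proof
  show "verts G \<subseteq> (\<Union>c\<in>sccs. verts c)"
    using scc_of_in_sccs_verts in_scc_of_self sccs_verts_conv by blast
  show "(\<Union>c\<in>sccs. verts c) \<subseteq> verts G"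
    by (meson UN_least in_sccs_imp_induced induced_imp_subgraph subgraph_imp_subverts)
qed

section \<open>Ordered strong components\<close>

locale ordered_components = digraph D for D :: "('a, 'b) pre_digraph" +
  fixes Q :: "nat \<Rightarrow> ('a, 'b) pre_digraph" and s :: nat
  assumes ordered: "ordered_strong_components D s Q"
begin

lemma bij_betw_components: "bij_betw Q {1..s} sccs"
  using ordered unfolding ordered_strong_components_def by (rule conjunct1)

lemma component_in_sccs: "i \<in> {1..s} \<Longrightarrow> Q i \<in> sccs"
  using bij_betw_components by (rule bij_betwE[THEN bspec])

lemma component_subgraph: "i \<in> {1..s} \<Longrightarrow> subgraph (Q i) D"
  by (intro induced_imp_subgraph in_sccs_imp_induced component_in_sccs)

lemma verts_conv_components: "verts D = (\<Union>i\<in>{1..s}. verts (Q i))"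
  unfolding Union_verts_sccs[symmetric] bij_betw_imp_surj_on[OF bij_betw_components, symmetric]
  by blast

lemma components_disjoint:
  assumes "i \<in> {1..s}" "j \<in> {1..s}" "u \<in> verts (Q i)" "u \<in> verts (Q j)"
  shows "i = j"
proof (rule ccontr)
  assume "i \<noteq> j"
  then have "Q i \<noteq> Q j"
    using bij_betw_imp_inj_on[OF bij_betw_components] assms(1,2) by (metis inj_on_contraD)
  then have "verts (Q i) \<inter> verts (Q j) = {}"
    using assms(1,2) by (intro scc_disj component_in_sccs)
  then show False using assms(3,4) by blast
qed

lemma dominates_component_le:
  assumes "i \<in> {1..s}" "j \<in> {1..s}" "u \<in> verts (Q i)" "v \<in> verts (Q j)" "u \<rightarrow>\<^bsub>D\<^esub> v"
  shows "i \<le> j"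
proof (rule ccontr)
  assume "\<not> i \<le> j"
  moreover have "\<forall>i\<in>{1..s}. \<forall>j\<in>{1..s}. i > j \<longrightarrow>
      \<not> (\<exists>u\<in>verts (Q i). \<exists>v\<in>verts (Q j). u \<rightarrow>\<^bsub>D\<^esub> v)"
    using ordered unfolding ordered_strong_components_def by blast
  ultimately have "\<not> (\<exists>u\<in>verts (Q i). \<exists>v\<in>verts (Q j). u \<rightarrow>\<^bsub>D\<^esub> v)"
    using assms(1,2) by (meson not_le_imp_less)
  then show False using assms(3-5) by blast
qed

text \<open>Beyond \<open>t\<close> every arc strictly increases the component index, which cannot
  exceed \<open>s\<close>.\<close>

lemma trailing_walk_bound:
  assumes triv: "\<And>j. t < j \<Longrightarrow> j \<le> s \<Longrightarrow> trivial_component (Q j)"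
    and "awalk u p w" "u \<in> verts (Q i)" "t < i" "i \<le> s"
  shows "i + length p \<le> s"
  using assms(2-)
proof (induction p arbitrary: u i)
  case (Cons e es)
  let ?v = "head D e"
  have e: "e \<in> arcs D" "tail D e = u" "awalk ?v es w"
    using Cons.prems(1) by (simp_all add: awalk_Cons_iff)
  then obtain j where j: "j \<in> {1..s}" "?v \<in> verts (Q j)"
    using verts_conv_components head_in_verts by blast
  have "u \<rightarrow>\<^bsub>D\<^esub> ?v" using e in_arcs_imp_in_arcs_ends by blast
  then have "i \<le> j" using dominates_component_le[of i j u ?v] j Cons.prems by simp
  \<comment> \<open>An arc that stays in a one-vertex component would be a loop.\<close>
  moreover have "i \<noteq> j"
  proof
    assume "i = j"
    then have "u = ?v"
      using triv[of i] j Cons.prems(2-4) by (metis card_1_singletonE singletonD trivial_component_def)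
    then show False using e(1,2) no_loops by metis
  qed
  ultimately have "j + length es \<le> s" using Cons.IH[of ?v j] e j Cons.prems by simp
  then show ?case using \<open>i \<le> j\<close> \<open>i \<noteq> j\<close> by simp
qed simp

end

section \<open>The limit graph and its isomorphism type\<close>

theorem proposition2p4:
  fixes D :: "('a, 'b) pre_digraph"
    and Q :: "nat \<Rightarrow> ('a, 'b) pre_digraph"
    and s t :: nat
  assumes "multipartite_tournament D"
    and "s \<ge> 2"
    and "ordered_strong_components D s Q"
    and "last_nontrivial_component s Q t"
    and "t < s"
    and "primitive_digraph (Q t)"
  shows "\<exists>G. graph_seq_converges (\<lambda>m. step_competition_graph m D) G \<and>
    digraph_iso (with_proj G)
      (with_proj (disjoint_union
        (complete_graph_on (components_span D Q 1 t))
        (edgeless_graph_on (components_span D Q (t + 1) s))))"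
proof -
  interpret digraph D using assms(1) by (rule multipartite_tournament_digraph)
  interpret ordered_components D Q s by unfold_locales fact
  have t: "t \<in> {1..s}" and triv: "\<And>i. t < i \<Longrightarrow> i \<le> s \<Longrightarrow> trivial_component (Q i)"
    using assms(4) by (auto simp: last_nontrivial_component_def)
  define A where "A = (\<Union>i\<in>{1..t}. verts (Q i))"
  define B where "B = (\<Union>i\<in>{t+1..s}. verts (Q i))"
  have "{1..s} = {1..t} \<union> {t+1..s}" using t by auto
  then have AB: "verts D = A \<union> B" unfolding verts_conv_components A_def B_def by auto
  have disj: "A \<inter> B = {}"
  proof (rule ccontr)
    assume "A \<inter> B \<noteq> {}"
    then obtain x i j where "i \<in> {1..t}" "j \<in> {t+1..s}" "x \<in> verts (Q i)" "x \<in> verts (Q j)"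
      unfolding A_def B_def by blast
    moreover from this have "i = j" using t by (intro components_disjoint[of i j x]) simp_all
    ultimately show False by simp
  qed
  interpret Qt: wf_digraph "Q t" using component_subgraph[OF t] by (simp add: subgraph_def)
  obtain a b where ab: "a \<rightarrow>\<^bsub>Q t\<^esub> b"
    using Qt.strongly_connected_ex_dominates assms(6)
    unfolding primitive_digraph_def trivial_component_def by blast
  have ab_Qt: "a \<in> verts (Q t)" "b \<in> verts (Q t)" using ab by (simp_all add: Qt.adj_in_verts)
  \<comment> \<open>The tail \<open>a\<close> of the chosen arc serves as the common target of all
    long walks. Walks inside \<open>Q t\<close> are also walks in \<open>D\<close>.\<close>
  have Qt_walk: "\<forall>\<^sub>F n in sequentially. walk_of_length n y a" if "y \<in> verts (Q t)" for y
    using Qt.primitive_eventually_walk[OF assms(6) that ab_Qt(1)]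
    by (rule eventually_mono) (rule subgraph_walk_of_length[OF component_subgraph[OF t]])
  have A_walk: "\<forall>\<^sub>F n in sequentially. walk_of_length n x a" if x: "x \<in> A" for x
  proof -
    obtain i where i: "i \<in> {1..t}" "x \<in> verts (Q i)" using x unfolding A_def by blast
    show ?thesis
    proof (cases "i = t")
      case True
      then show ?thesis using Qt_walk i by simp
    next
      case False
      \<comment> \<open>Now \<open>x\<close> lies in a component before \<open>Q t\<close>, so no
        arc leads from \<open>Q t\<close> back to \<open>x\<close>, and its arc to or from
        \<open>y\<close> must enter \<open>Q t\<close>. Whichever end \<open>y\<close> is,
        \<open>Qt_walk\<close> continues from there to \<open>a\<close>.\<close>
      have "a \<rightarrow>\<^bsub>D\<^esub> b" using ab component_subgraph[OF t] by (meson adj_mono)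
      then obtain y where y: "y \<in> {a, b}" "x \<rightarrow>\<^bsub>D\<^esub> y \<or> y \<rightarrow>\<^bsub>D\<^esub> x"
        using multipartite_tournament_adjacent_end[OF assms(1)] x AB by blast
      then have "y \<in> verts (Q t)" using ab_Qt by auto
      moreover from this have "\<not> y \<rightarrow>\<^bsub>D\<^esub> x" using dominates_component_le[of t i y x] False i t by auto
      ultimately show ?thesis
        using y eventually_walk_of_length_trans[OF walk_of_length_1 Qt_walk] by blast
    qed
  qed
  define G where
    "G = \<lparr> pverts = verts D, parcs = {(u, v). u \<in> A \<and> v \<in> A \<and> u \<noteq> v} \<rparr>"
  \<comment> \<open>Finiteness turns the separate thresholds for the vertices of \<open>A\<close>
    into a common one.\<close>
  have "finite A" using AB finite_verts by (metis finite_Un)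
  then have "\<forall>\<^sub>F n in sequentially. \<forall>x\<in>A. walk_of_length n x a"
    using A_walk by (simp add: eventually_ball_finite)
  moreover have "\<forall>\<^sub>F n in sequentially. \<forall>x\<in>B. \<forall>w. \<not> walk_of_length n x w"
  \<comment> \<open>The threshold \<open>s\<close> suffices: a walk from \<open>Q i\<close> with
    \<open>i > t\<close> has length at most \<open>s - i\<close>, and \<open>i\<close> is
    positive.\<close>
  proof (rule eventually_sequentiallyI[of s], intro ballI allI notI)
    fix n x w assume n: "s \<le> n" and "x \<in> B" "walk_of_length n x w"
    then obtain i p where "i \<in> {t+1..s}" "x \<in> verts (Q i)" "awalk x p w" "length p = n"
      unfolding B_def walk_of_length_def by blast
    then have "i + n \<le> s" "t < i" using trailing_walk_bound[of t x p w i, OF triv] by simp_all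
    then show False using n by simp
  qed
  \<comment> \<open>For such \<open>n\<close>, any two vertices of \<open>A\<close> share the target
    \<open>a\<close>, while a vertex of \<open>B\<close> starts no walk of length \<open>n\<close>
    and is therefore isolated.\<close>
  ultimately have "\<forall>\<^sub>F n in sequentially. step_competition_graph n D = G"
  proof eventually_elim
    case (elim n)
    then show ?case
      unfolding step_competition_graph_def G_def walk_of_length_def[symmetric] AB by auto
  qed
  moreover have "digraph_iso (with_proj G)
      (with_proj (disjoint_union
        (complete_graph_on (components_span D Q 1 t))
        (edgeless_graph_on (components_span D Q (t + 1) s))))"
  proof -
    \<comment> \<open>The disjoint union lives on a sum type, so \<open>f\<close> tags the vertices
      by side. Arcs under \<open>with_proj\<close> are pairs of vertices, whence
      \<open>map_prod f f\<close> on arcs.\<close>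
    define f where "f v = (if v \<in> A then Inl v else Inr v :: 'a + 'a)" for v
    define h where "h = \<lparr> iso_verts = f, iso_arcs = map_prod f f, iso_head = snd, iso_tail = fst \<rparr>"
    have "inj f" by (auto simp: inj_def f_def)
    then have "inj (map_prod f f)" by (simp add: prod.inj_map)
    moreover have "wf_digraph (with_proj G)"
      by unfold_locales (auto simp: G_def AB)
    ultimately have "pre_digraph.digraph_isomorphism (with_proj G) h"
      using \<open>inj f\<close> by (auto simp: pre_digraph.digraph_isomorphism_def h_def intro: inj_on_subset)
    moreover have "f ` verts D = A <+> B"
      using AB disj by (force simp: f_def)
    \<comment> \<open>Both ends of every arc of \<open>G\<close> lie in \<open>A\<close>, where
      \<open>f\<close> is \<open>Inl\<close>; the \<open>Inr\<close> side has no arcs.\<close>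
    moreover have "map_prod f f ` parcs G = map_prod Inl Inl ` parcs G"
      by (rule image_cong) (auto simp: f_def G_def)
    ultimately show ?thesis
      unfolding digraph_iso_def
      by (intro exI[of _ h]) (simp add: h_def app_iso_def disjoint_union_def complete_graph_on_def
          edgeless_graph_on_def components_span_def with_proj_def G_def A_def B_def)
  qed
  ultimately show ?thesis unfolding graph_seq_converges_def by blast
qed

end
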